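(* Let $p$ be an odd prime and let $k\ge 1$, $\alpha\ge 1$ be integers. Then $U^{k}(\mathbb{Z}_{p^{\alpha}})$ is trivial if and only if $\alpha<k$ and $U^{k-\alpha+1}(\mathbb{Z}_{p})\approx\{0\}$.
   Context: For an integer $n\ge 1$, $\mathbb{Z}_n$ is the ring of integers modulo $n$ ($\mathbb{Z}_1=\{0\}$). For a finite commutative ring $R$ with identity (the zero ring is allowed, with $U(\{0\})=\{0\}$), $U(R)$ is its group of units. Since $U(R)$ is a finite abelian group, it is isomorphic to a product $\mathbb{Z}_{n_1}\times\cdots\times\mathbb{Z}_{n_i}$ of cyclic groups, and $U(R)$ is regarded as a ring by transporting the ring structure of $\mathbb{Z}_{n_1}\oplus\cdots\oplus\mathbb{Z}_{n_i}$ (up to ring isomorphism this does not depend on the chosen decomposition). The $k$-th (generalized) group of units is defined by $U^0(R)=R$, $U^1(R)=U(R)$ and $U^k(R)=U(U^{k-1}(R))$, where $U^{k-1}(R)$ is viewed as a ring in this way. The symbol $\approx$ denotes isomorphism (as groups, equivalently as rings with these structures). "Trivial" means having exactly one element; $\{0\}$ is the trivial group (ring). *)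

theory Defs
  imports "HOL-Algebra.Algebra" "HOL-Computational_Algebra.Primes"
begin

definition cyclic_sum :: "nat list \<Rightarrow> int set list ring" where
  "cyclic_sum ns = RDirProd_list (map (\<lambda>n. ZFact (int n)) ns)"

definition unit_decomposition :: "'a ring \<Rightarrow> nat list \<times> ('a \<Rightarrow> int set list) \<Rightarrow> bool" where
  "unit_decomposition R = (\<lambda>(ns, \<phi>).
     ns \<noteq> [] \<and> (\<forall>n\<in>set ns. n \<ge> 1) \<and> \<phi> \<in> iso (units_of R) (add_monoid (cyclic_sum ns)))"

(* The group of units as a ring: the multiplication of R becomes the addition (so the one of R
   becomes the zero), and the ring multiplication is transported along a chosen decomposition.
   A decomposition exists whenever R is a finite commutative ring; the definition is only
   meaningful for such R. *)
definition units_ring :: "'a ring \<Rightarrow> 'a ring" where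
  "units_ring R =
     (let (ns, \<phi>) = (SOME d. unit_decomposition R d);
          \<psi> = inv_into (Units R) \<phi>
      in \<lparr>carrier = Units R,
          monoid.mult = (\<lambda>x y. \<psi> (\<phi> x \<otimes>\<^bsub>cyclic_sum ns\<^esub> \<phi> y)),
          one = \<psi> \<one>\<^bsub>cyclic_sum ns\<^esub>,
          ring.zero = \<one>\<^bsub>R\<^esub>,
          ring.add = monoid.mult R\<rparr>)"

primrec gen_units :: "nat \<Rightarrow> 'a ring \<Rightarrow> 'a ring" where
  "gen_units 0 R = R"
| "gen_units (Suc k) R = units_ring (gen_units k R)"

end

theory Submission
  imports Defs "HOL-Number_Theory.Residue_Primitive_Roots"
begin

text \<open>
  The statement reduces to elementary number theory because the triviality of iterated unit rings
  is governed by exponents alone. A ring \<open>R\<close> that is a direct sum of residue rings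
  \<open>\<int>\<^sub>n\<close> has an additive exponent \<open>e\<close>, the least common multiple of the moduli, and it is
  trivial if and only if \<open>e = 1\<close>. The exponent of its group of units is \<open>\<lambda>(e)\<close>, with \<open>\<lambda>\<close> denoting
  Carmichael's function, because \<open>\<lambda>\<close> sends least common multiples to least common multiples
  (\<open>Carmichael_lcm\<close>). Regarded as a ring, the group of units is again such a direct sum, now of
  additive exponent \<open>\<lambda>(e)\<close>. Iterating, \<open>U\<^sup>k(\<int>\<^sub>n)\<close> has additive exponent \<open>\<lambda>\<^sup>k(n)\<close>
  (\<open>carmichael_ring_gen_units\<close>) and is trivial if and only if \<open>\<lambda>\<^sup>k(n) = 1\<close>.

  The ring structure on the units depends on a chosen decomposition into cyclic groups, but the
  exponent of its additive group is the exponent of the group of units, whatever the choice. That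
  there is a decomposition to choose is \<open>finite_comm_group_iso_cyclic_sum\<close>, which rests on the fact
  that a cyclic subgroup generated by an element of maximal order has a complement
  (\<open>cyclic_subgroup_has_complement\<close>).

  For an odd prime \<open>p\<close> one has \<open>\<lambda>(p\<^sup>a\<^sup>+\<^sup>1) = p\<^sup>a (p - 1) = lcm(p\<^sup>a, \<lambda>(p))\<close>, whence
  \<open>\<lambda>\<^sup>k(p\<^sup>a\<^sup>+\<^sup>1) = lcm(\<lambda>\<^sup>k\<^sup>-\<^sup>1(p\<^sup>a), \<lambda>\<^sup>k(p))\<close>. Unfolding this down to the exponent \<open>1\<close> leaves
  the single condition that the iterate of order \<open>k - \<alpha> + 1\<close> at \<open>p\<close> equals \<open>1\<close>
  (\<open>Carmichael_funpow_prime_power\<close>), and the bound \<open>\<alpha> < k\<close> appears because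
  \<open>\<lambda>(p) = p - 1 \<noteq> 1\<close>.
\<close>

section \<open>Elements of maximal order in finite abelian groups\<close>

lemma (in comm_group) ord_dvd_ord_mult:
  assumes x: "x \<in> carrier G" and y: "y \<in> carrier G" and co: "coprime (ord x) (ord y)"
  shows "ord x dvd ord (x \<otimes> y)"
proof -
  let ?d = "ord (x \<otimes> y) * ord y"
  have "x [^] ?d \<otimes> y [^] ?d = (x \<otimes> y) [^] ?d"
    using x y by (simp add: pow_mult_distrib m_comm)
  also have "\<dots> = \<one>"
    using x y by (subst pow_eq_id) auto
  also have "y [^] ?d = \<one>"
    using y by (simp add: pow_eq_id)
  finally have "x [^] ?d = \<one>"
    using x by simp
  then have "ord x dvd ?d"
    using x by (simp add: pow_eq_id)
  then show ?thesis
    using co by (simp add: coprime_dvd_mult_left_iff)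
qed

lemma (in comm_group) ord_mult_coprime:
  assumes x: "x \<in> carrier G" and y: "y \<in> carrier G" and co: "coprime (ord x) (ord y)"
  shows "ord (x \<otimes> y) = ord x * ord y"
proof (rule dvd_antisym)
  show "ord (x \<otimes> y) dvd ord x * ord y"
    using x y by (rule abelian_ord_mul_divides)
  have "ord y dvd ord (x \<otimes> y)"
    using ord_dvd_ord_mult[OF y x] co m_comm[OF x y] by (simp add: coprime_commute)
  then show "ord x * ord y dvd ord (x \<otimes> y)"
    using ord_dvd_ord_mult[OF assms] co by (simp add: divides_mult)
qed

text \<open>
  An element \<open>a\<close> of maximal order works: if some prime \<open>p\<close> occurred to a higher power in the
  order of \<open>x\<close>, then combining the \<open>p\<close>-part of \<open>x\<close> with the prime-to-\<open>p\<close> part of \<open>a\<close> would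
  produce, by coprimality, an element of larger order.
\<close>

lemma (in comm_group) ex_elem_of_exponent_order:
  assumes fin: "finite (carrier G)"
  shows "\<exists>a\<in>carrier G. \<forall>x\<in>carrier G. ord x dvd ord a"
proof -
  let ?M = "Max (ord ` carrier G)"
  have pos: "ord x > 0" if "x \<in> carrier G" for x
    using ord_ge_1[OF fin that] by simp
  have "?M \<in> ord ` carrier G"
    using fin by (intro Max_in) auto
  then obtain a where a: "a \<in> carrier G" "ord a = ?M"
    by auto
  have max: "ord x \<le> ord a" if "x \<in> carrier G" for x
    using fin that by (simp add: a(2))
  have "ord x dvd ord a" if x: "x \<in> carrier G" for x
  proof (rule ccontr)
    assume "\<not> ord x dvd ord a"
    then have "\<exists>p. Factorial_Ring.prime p \<and> \<not> multiplicity p (ord x) \<le> multiplicity p (ord a)"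
      using multiplicity_le_imp_dvd[of "ord x" "ord a"] pos[OF x] by auto
    then obtain p where p: "Factorial_Ring.prime p"
      and less: "multiplicity p (ord a) < multiplicity p (ord x)"
      by (auto simp: not_le)
    define i j where "i = multiplicity p (ord a)" and "j = multiplicity p (ord x)"
    have np: "\<not> is_unit p"
      using p not_prime_unit by blast
    obtain m where m: "ord a = p ^ i * m" "\<not> p dvd m"
      unfolding i_def using multiplicity_decompose'[of "ord a" p] pos[OF a(1)] np by blast
    obtain n where n: "ord x = p ^ j * n"
      unfolding j_def using multiplicity_decompose'[of "ord x" p] pos[OF x] np by blast
    have p0: "p > 0" and n0: "n > 0" and m0: "m > 0"
      using prime_gt_0_nat[OF p] pos[OF x] pos[OF a(1)] unfolding n m(1) by auto
    have oa: "ord (a [^] (p ^ i)) = m"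
      using a(1) p0 m(1) by (subst ord_pow) auto
    have ox: "ord (x [^] n) = p ^ j"
      using x n0 n by (subst ord_pow) auto
    have "coprime (ord (a [^] (p ^ i))) (ord (x [^] n))"
      unfolding oa ox using prime_imp_coprime[OF p m(2)] by (simp add: coprime_commute)
    then have "ord (a [^] (p ^ i) \<otimes> x [^] n) = m * p ^ j"
      using a(1) x by (subst ord_mult_coprime) (auto simp: oa ox)
    moreover have "m * p ^ j > m * p ^ i"
      using less prime_gt_1_nat[OF p] m0 by (simp add: i_def j_def)
    ultimately show False
      using max[of "a [^] (p ^ i) \<otimes> x [^] n"] a(1) x m(1) by (simp add: mult.commute)
  qed
  then show ?thesis
    using a(1) by blast
qed

section \<open>Complements of cyclic subgroups\<close>

lemma (in group) subgroup_nat_pow_closed: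
  assumes "subgroup H G" and "x \<in> H"
  shows "x [^] (n::nat) \<in> H"
  by (induction n) (simp_all add: subgroup.one_closed[OF assms(1)] subgroup.m_closed[OF assms(1) _ assms(2)])

lemma (in group) subgroup_mult_cancel:
  assumes "subgroup H G" and "x \<in> carrier G" and "h \<in> H" and "x \<otimes> h \<in> H"
  shows "x \<in> H"
proof -
  have hc: "h \<in> carrier G"
    using subgroup.mem_carrier[OF assms(1,3)] .
  have "x \<otimes> h \<otimes> inv h \<in> H"
    using subgroup.m_closed[OF assms(1,4) subgroup.m_inv_closed[OF assms(1,3)]] .
  then show ?thesis
    using hc assms(2) by (simp add: m_assoc)
qed

text \<open>
  Bezout: \<open>x\<close> is a product of powers of \<open>x [^] m\<close> and \<open>x [^] n\<close>, up to inverses.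
\<close>

lemma (in group) mem_subgroup_of_coprime_pows:
  assumes H: "subgroup H G" and x: "x \<in> carrier G"
    and m: "x [^] m \<in> H" and n: "x [^] n \<in> H" and co: "coprime m (n::nat)"
  shows "x \<in> H"
proof (cases "m = 0")
  case True
  then show ?thesis
    using co n x by simp
next
  case False
  then obtain u v where uv: "m * u = n * v + 1"
    using bezout_nat[of m n] co by auto
  have "x \<otimes> x [^] (n * v) = x [^] (m * u)"
    unfolding uv using x nat_pow_Suc2[OF x, of "n * v"] by simp
  also have "\<dots> = (x [^] m) [^] u"
    using x by (simp add: nat_pow_pow)
  also have "\<dots> \<in> H"
    using H m by (rule subgroup_nat_pow_closed)
  finally have "x \<otimes> x [^] (n * v) \<in> H" .
  moreover have "x [^] (n * v) \<in> H"
    using subgroup_nat_pow_closed[OF H n, of v] x by (simp add: nat_pow_pow)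
  ultimately show ?thesis
    using subgroup_mult_cancel[OF H x] by blast
qed

text \<open>
  A coset-free form of the fact that a non-trivial finite quotient contains an element of prime
  order: \<open>y\<close> is the power of \<open>x\<close> whose exponent is \<open>d / p\<close>, where \<open>d\<close> is the order of \<open>x\<close>
  modulo \<open>H\<close> and \<open>p\<close> a prime divisor of \<open>d\<close>.
\<close>

lemma (in group) ex_prime_pow_mem_subgroup:
  assumes H: "subgroup H G" and x: "x \<in> carrier G" "x \<notin> H" and n: "x [^] n = \<one>" "n > (0::nat)"
  obtains p y where "Factorial_Ring.prime (p::nat)" "y \<in> carrier G" "y \<notin> H" "y [^] p \<in> H"
proof -
  define d where "d = (LEAST d::nat. d > 0 \<and> x [^] d \<in> H)"
  have "n > 0 \<and> x [^] n \<in> H"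
    using n subgroup.one_closed[OF H] by simp
  then have d: "d > 0" "x [^] d \<in> H"
    using LeastI[of "\<lambda>d. d > 0 \<and> x [^] d \<in> H" n] unfolding d_def by blast+
  have least: "x [^] e \<notin> H" if "0 < e" "e < d" for e
    using that not_less_Least[of e] unfolding d_def by blast
  have "d \<noteq> 1"
    using d x by auto
  then obtain p where p: "Factorial_Ring.prime p" "p dvd d"
    using prime_factor_nat[of d] by blast
  from p(2) obtain e where e: "d = p * e" ..
  then have e': "0 < e" "e < d"
    using d(1) prime_gt_1_nat[OF p(1)] by auto
  show thesis
  proof
    show "Factorial_Ring.prime p" "x [^] e \<in> carrier G" "x [^] e \<notin> H" "(x [^] e) [^] p \<in> H"
      using p(1) least[OF e'] d(2) x(1) by (auto simp: nat_pow_pow e mult.commute)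
  qed
qed

lemma (in group) subset_set_mult_subgroups:
  assumes H: "subgroup H G" and K: "subgroup K G"
  shows "H \<subseteq> H <#> K" and "K \<subseteq> H <#> K"
proof -
  have "x \<otimes> \<one> \<in> H <#> K" if "x \<in> H" for x
    unfolding set_mult_def using that subgroup.one_closed[OF K] by blast
  then show "H \<subseteq> H <#> K"
    using subgroup.mem_carrier[OF H] by (metis r_one subsetI)
  have "\<one> \<otimes> x \<in> H <#> K" if "x \<in> K" for x
    unfolding set_mult_def using that subgroup.one_closed[OF H] by blast
  then show "K \<subseteq> H <#> K"
    using subgroup.mem_carrier[OF K] by (metis l_one subsetI)
qed

text \<open>
  This is the step that splits off one cyclic factor. Take \<open>H\<close> maximal among the subgroups that
  meet \<open>\<langle>a\<rangle>\<close> trivially and suppose that \<open>K = \<langle>a\<rangle> H\<close> is not everything. Some \<open>y\<close> outside \<open>K\<close> has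
  \<open>y [^] p \<in> K\<close> for a prime \<open>p\<close>, say \<open>y [^] p = a [^] i \<otimes> h\<close>. Because the order of \<open>a\<close> is the
  exponent of the group, \<open>p\<close> divides \<open>i\<close>, so that \<open>y\<close> can be corrected by a power of \<open>a\<close> to an
  element \<open>z\<close> outside \<open>K\<close> with \<open>z [^] p \<in> H\<close>. Then \<open>\<langle>z\<rangle> H\<close> still meets \<open>\<langle>a\<rangle>\<close> trivially, against
  the maximality of \<open>H\<close>.
\<close>

theorem (in comm_group) cyclic_subgroup_has_complement:
  assumes fin: "finite (carrier G)" and a: "a \<in> carrier G"
    and exp: "\<And>x. x \<in> carrier G \<Longrightarrow> ord x dvd ord a"
  shows "\<exists>H. subgroup H G \<and> generate G {a} \<inter> H = {\<one>} \<and> generate G {a} <#> H = carrier G"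
proof -
  let ?A = "generate G {a}"
  have A: "subgroup ?A G"
    using a by (simp add: generate_is_subgroup)
  have A_eq: "?A = {a [^] k |k. k \<in> (UNIV::nat set)}"
    using fin a by (rule generate_pow_on_finite_carrier)
  then have pow_in_A: "a [^] k \<in> ?A" for k :: nat
    by blast
  have pow_ord: "x [^] ord a = \<one>" if "x \<in> carrier G" for x
    using exp that by (simp add: pow_eq_id)
  let ?F = "{H. subgroup H G \<and> ?A \<inter> H = {\<one>}}"
  have "{\<one>} \<in> ?F"
    using subgroup.one_closed[OF A] by (auto simp: triv_subgroup)
  moreover have "finite ?F"
    by (rule finite_subset[of _ "Pow (carrier G)"]) (use fin in \<open>auto dest: subgroup.subset\<close>)
  ultimately have "\<exists>H\<in>?F. \<forall>H'\<in>?F. H \<subseteq> H' \<longrightarrow> H = H'"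
    by (intro finite_has_maximal) auto
  then obtain H where "H \<in> ?F" and max: "\<forall>H'\<in>?F. H \<subseteq> H' \<longrightarrow> H = H'" ..
  then have H: "subgroup H G" "?A \<inter> H = {\<one>}"
    by simp_all
  have maximal: "H = H'" if "subgroup H' G" "?A \<inter> H' = {\<one>}" "H \<subseteq> H'" for H'
    using bspec[OF max, of H'] that by simp
  define K where "K = ?A <#> H"
  have K: "subgroup K G"
    unfolding K_def using A H(1) by (rule mult_subgroups)
  have AK: "?A \<subseteq> K" and HK: "H \<subseteq> K"
    unfolding K_def using A H(1) by (rule subset_set_mult_subgroups)+
  have "x \<in> K" if x: "x \<in> carrier G" for x
  proof (rule ccontr)
    assume "x \<notin> K"
    moreover have "ord a > 0"
      using ord_ge_1[OF fin a] by simp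
    ultimately obtain p y where p: "Factorial_Ring.prime (p::nat)"
      and y: "y \<in> carrier G" "y \<notin> K" "y [^] p \<in> K"
      using ex_prime_pow_mem_subgroup[OF K x _ pow_ord[OF x]] by blast
    obtain i h where h: "h \<in> H" and yp: "y [^] p = a [^] (i::nat) \<otimes> h"
      using y(3) unfolding K_def set_mult_def A_eq by blast
    have hc: "h \<in> carrier G"
      using h subgroup.mem_carrier[OF H(1)] by blast
    \<comment> \<open>Otherwise \<open>p\<close> is coprime to the exponent of the group, and \<open>y\<close> is a power of \<open>y [^] p\<close>.\<close>
    have "p dvd ord a"
    proof (rule ccontr)
      assume "\<not> p dvd ord a"
      then have "coprime p (ord a)"
        using p by (simp add: prime_imp_coprime)
      then show False
        using mem_subgroup_of_coprime_pows[OF K y(1,3), of "ord a"] y(2) pow_ord[OF y(1)]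
          subgroup.one_closed[OF K] by simp
    qed
    then obtain q where q: "ord a = p * q" ..
    have q0: "q > 0"
      using \<open>ord a > 0\<close> q by (auto intro: Nat.gr0I)
    \<comment> \<open>Raised to the power \<open>q\<close>, the left side vanishes, which puts a power of \<open>a\<close> into \<open>H\<close>.\<close>
    have "a [^] (i * q) \<otimes> h [^] q = (y [^] p) [^] q"
      unfolding yp using a hc by (simp add: pow_mult_distrib m_comm nat_pow_pow)
    also have "\<dots> = \<one>"
      using pow_ord[OF y(1)] y(1) by (simp add: nat_pow_pow q)
    finally have "a [^] (i * q) \<otimes> h [^] q \<in> H"
      using subgroup.one_closed[OF H(1)] by simp
    then have "a [^] (i * q) \<in> H"
      using subgroup_mult_cancel[OF H(1)] subgroup_nat_pow_closed[OF H(1) h] a by blast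
    then have "a [^] (i * q) = \<one>"
      using H(2) pow_in_A by blast
    then have "p * q dvd i * q"
      using a by (simp add: pow_eq_id q)
    then have "p dvd i"
      using q0 by simp
    then obtain j where j: "i = p * j" ..
    define z where "z = y \<otimes> inv (a [^] j)"
    have z: "z \<in> carrier G"
      using a y by (simp add: z_def)
    have aj: "a [^] j \<in> K"
      using AK pow_in_A by blast
    have zK: "z \<notin> K"
    proof
      assume "z \<in> K"
      then have "z \<otimes> a [^] j \<in> K"
        using subgroup.m_closed[OF K] aj by blast
      then show False
        using a y by (simp add: z_def m_assoc)
    qed
    have "z [^] p = y [^] p \<otimes> inv (a [^] i)"
      using a y by (simp add: z_def pow_mult_distrib m_comm nat_pow_inv nat_pow_pow j mult.commute)
    also have "\<dots> = h"
      unfolding yp using a hc by (simp add: m_comm[of "a [^] i" h] m_assoc)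
    finally have zp: "z [^] p \<in> H"
      using h by simp
    define H' where "H' = generate G {z} <#> H"
    have Z_eq: "generate G {z} = {z [^] k |k. k \<in> (UNIV::nat set)}"
      using fin z by (rule generate_pow_on_finite_carrier)
    have Z: "subgroup (generate G {z}) G"
      using z by (simp add: generate_is_subgroup)
    have H': "subgroup H' G"
      unfolding H'_def using Z H(1) by (rule mult_subgroups)
    have "H \<subseteq> H'" and "z \<in> H'"
      unfolding H'_def using subset_set_mult_subgroups[OF Z H(1)] generate.incl[of z "{z}" G] by blast+
    moreover have "?A \<inter> H' = {\<one>}"
    proof (intro equalityI subsetI)
      fix w assume w: "w \<in> ?A \<inter> H'"
      then obtain t h' where h': "h' \<in> H" and wt: "w = z [^] (t::nat) \<otimes> h'"
        unfolding H'_def set_mult_def Z_eq by blast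
      have "p dvd t"
      proof (rule ccontr)
        assume "\<not> p dvd t"
        then have "coprime p t"
          using p by (simp add: prime_imp_coprime)
        moreover have "z [^] t \<in> K"
          using subgroup_mult_cancel[OF K, of "z [^] t" h'] h' w wt AK HK z by auto
        ultimately show False
          using mem_subgroup_of_coprime_pows[OF K z, of p t] zp HK zK by blast
      qed
      then obtain s where "t = p * s" ..
      then have "z [^] t \<in> H"
        using subgroup_nat_pow_closed[OF H(1) zp, of s] z by (simp add: nat_pow_pow)
      then have "w \<in> H"
        unfolding wt using h' subgroup.m_closed[OF H(1)] by blast
      then show "w \<in> {\<one>}"
        using w H(2) by blast
    qed (use subgroup.one_closed[OF A] subgroup.one_closed[OF H'] in auto)
    ultimately show False
      using maximal[OF H'] HK zK by blast
  qed
  then have "K = carrier G"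
    using subgroup.subset[OF K] by blast
  then show ?thesis
    using H by (auto simp: K_def)
qed

section \<open>Finite abelian groups as direct sums of residue groups\<close>

lemma carrier_ZFact: "carrier (ZFact k) = range (ZMod k)"
  by (auto simp: ZFact_def FactRing_def A_RCOSETS_def' ZMod_def)

lemma ZMod_hom: "ZMod k \<in> ring_hom \<Z> (ZFact k)"
  unfolding ZMod_def ZFact_def by (intro ideal.rcos_ring_hom int.genideal_ideal) simp

lemma ZMod_mult: "ZMod k x \<otimes>\<^bsub>ZFact k\<^esub> ZMod k y = ZMod k (x * y)"
  using ring_hom_mult[OF ZMod_hom, of x y k] by simp

lemma ZMod_add: "ZMod k x \<oplus>\<^bsub>ZFact k\<^esub> ZMod k y = ZMod k (x + y)"
  using ring_hom_add[OF ZMod_hom, of x y k] by simp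

lemma ZMod_one: "\<one>\<^bsub>ZFact k\<^esub> = ZMod k 1"
  using ring_hom_one[OF ZMod_hom, of k] by simp

lemma ZMod_zero: "\<zero>\<^bsub>ZFact k\<^esub> = ZMod k 0"
proof -
  interpret cring "ZFact k" by (rule ZFact_is_cring)
  have "ZMod k 0 \<oplus>\<^bsub>ZFact k\<^esub> ZMod k 0 = ZMod k 0"
    by (simp add: ZMod_add)
  then show ?thesis
    by (metis carrier_ZFact rangeI r_zero add.l_cancel zero_closed)
qed

lemma ring_iso_imp_add_iso: "h \<in> ring_iso R S \<Longrightarrow> h \<in> iso (add_monoid R) (add_monoid S)"
  by (auto simp: ring_iso_def ring_hom_def iso_def hom_def)

lemma cyclic_sum_Cons_iso:
  "(\<lambda>(x, xs). x # xs) \<in> ring_iso (RDirProd (ZFact (int n)) (cyclic_sum ns)) (cyclic_sum (n # ns))"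
  using RDirProd_list_iso1 by (simp add: cyclic_sum_def)

lemma cyclic_sum_Cons_add_iso:
  "add_monoid (ZFact (int n)) \<times>\<times> add_monoid (cyclic_sum ns) \<cong> add_monoid (cyclic_sum (n # ns))"
  using ring_iso_imp_add_iso[OF cyclic_sum_Cons_iso] unfolding RDirProd_add_monoid by (rule is_isoI)

lemma add_group_ZFact: "group (add_monoid (ZFact k))"
  by (intro abelian_group.a_group ring.is_abelian_group cring.axioms(1) ZFact_is_cring)

text \<open>
  The isomorphism is the discrete logarithm to the base \<open>a\<close>, which is well defined modulo the
  order of \<open>a\<close>.
\<close>

lemma (in group) cyclic_subgroup_iso_ZFact:
  assumes a: "a \<in> carrier G"
  shows "subgroup_generated G (generate G {a}) \<cong> add_monoid (ZFact (int (ord a)))"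
proof -
  let ?m = "int (ord a)"
  define g where "g x = ZMod ?m (SOME i::int. a [^] i = x)" for x
  have g: "g (a [^] i) = ZMod ?m i" for i :: int
  proof -
    have "a [^] (SOME j::int. a [^] j = a [^] i) = a [^] i"
      by (rule someI[of _ i]) simp
    then show ?thesis
      unfolding g_def ZMod_eq_mod mod_eq_dvd_iff using int_pow_eq[OF a] by (metis)
  qed
  have gen: "generate G {a} = range (\<lambda>i::int. a [^] i)"
    using generate_pow[OF a] by auto
  have carr: "carrier (subgroup_generated G (generate G {a})) = range (\<lambda>i::int. a [^] i)"
    using subgroup.carrier_subgroup_generated_subgroup[OF generate_is_subgroup, of "{a}"] a
    by (simp add: gen)
  have "g \<in> iso (subgroup_generated G (generate G {a})) (add_monoid (ZFact ?m))"
  proof (rule isoI)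
    show "g \<in> hom (subgroup_generated G (generate G {a})) (add_monoid (ZFact ?m))"
      using a by (auto simp: hom_def carr g carrier_ZFact ZMod_add simp flip: int_pow_mult)
    have "inj_on g (range (\<lambda>i::int. a [^] i))"
      using int_pow_eq[OF a] by (auto simp: inj_on_def g ZMod_eq_mod mod_eq_dvd_iff dvd_diff_commute)
    moreover have "g ` range (\<lambda>i::int. a [^] i) = range (ZMod ?m)"
      by (simp add: image_image g)
    ultimately show "bij_betw g (carrier (subgroup_generated G (generate G {a}))) (carrier (add_monoid (ZFact ?m)))"
      by (simp add: bij_betw_def carr carrier_ZFact)
  qed
  then show ?thesis
    by (rule is_isoI)
qed

lemma singleton_groups_iso:
  assumes "group G" "group H" "carrier G = {x}" "carrier H = {y}"
  shows "G \<cong> H"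
proof (rule is_isoI, rule isoI)
  have "y \<otimes>\<^bsub>H\<^esub> y = y"
    using assms(4) monoid.m_closed[OF group.is_monoid[OF assms(2)], of y y] by simp
  then show "(\<lambda>_. y) \<in> hom G H"
    using assms by (auto simp: hom_def)
qed (use assms in \<open>auto simp: bij_betw_def\<close>)

lemma cring_RDirProd:
  assumes "cring R" "cring S"
  shows "cring (RDirProd R S)"
proof -
  interpret R: cring R by fact
  interpret S: cring S by fact
  interpret ring "RDirProd R S"
    by (intro RDirProd_ring R.ring_axioms S.ring_axioms)
  show ?thesis
    by (unfold_locales) (auto simp: RDirProd_def DirProd_def monoid.defs R.m_comm S.m_comm)
qed

lemma cring_cyclic_sum: "cring (cyclic_sum ns)"
proof (induction ns)
  case Nil
  interpret ring "cyclic_sum []"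
    unfolding cyclic_sum_def by (rule RDirProd_list_is_ring) simp
  show ?case
    by unfold_locales (simp add: cyclic_sum_def monoid.defs)
next
  case (Cons n ns)
  let ?P = "RDirProd (ZFact (int n)) (cyclic_sum ns)"
  interpret P: cring ?P
    by (intro cring_RDirProd ZFact_is_cring Cons.IH)
  have "(\<lambda>(x, xs). x # xs) \<zero>\<^bsub>?P\<^esub> = \<zero>\<^bsub>cyclic_sum (n # ns)\<^esub>"
    unfolding cyclic_sum_def by (simp add: RDirProd_list_zero' RDirProd_def monoid.defs)
  then show ?case
    using P.ring_iso_imp_img_cring[OF cyclic_sum_Cons_iso] by simp
qed

lemma add_group_cyclic_sum: "group (add_monoid (cyclic_sum ns))"
  by (intro abelian_group.a_group ring.is_abelian_group cring.axioms(1) cring_cyclic_sum)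

text \<open>
  The structure theorem for finite abelian groups, in the existence half: split off the cyclic
  subgroup generated by an element of maximal order and continue with a complement. It guarantees
  that the choice in the definition of \<^const>\<open>units_ring\<close> picks an actual decomposition.
\<close>

theorem finite_comm_group_iso_cyclic_sum:
  assumes "comm_group G" "finite (carrier G)"
  shows "\<exists>ns. ns \<noteq> [] \<and> (\<forall>n\<in>set ns. n \<ge> 1) \<and> G \<cong> add_monoid (cyclic_sum ns)"
  using assms
proof (induction "card (carrier G)" arbitrary: G rule: less_induct)
  case (less G)
  interpret comm_group G by fact
  obtain a where a: "a \<in> carrier G" and exp: "\<forall>x\<in>carrier G. ord x dvd ord a"
    using ex_elem_of_exponent_order[OF less.prems(2)] by blast
  obtain H where H: "subgroup H G" "generate G {a} \<inter> H = {\<one>\<^bsub>G\<^esub>}" "generate G {a} <#>\<^bsub>G\<^esub> H = carrier G"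
    using cyclic_subgroup_has_complement[OF less.prems(2) a bspec[OF exp]] by blast
  have A: "subgroup (generate G {a}) G"
    using a by (simp add: generate_is_subgroup)
  interpret group_disjoint_sum G "generate G {a}" H
    by (intro group_disjoint_sum.intro A H(1) group_axioms)
  let ?A = "subgroup_generated G (generate G {a})" and ?H = "subgroup_generated G H"
  have "(\<lambda>(x, y). x \<otimes>\<^bsub>G\<^esub> y) \<in> iso (?A \<times>\<times> ?H) G"
    using H(2,3) by (simp add: iso_group_mul[OF less.prems(1)])
  then have "?A \<times>\<times> ?H \<cong> G"
    by (rule is_isoI)
  then have G_iso: "G \<cong> ?A \<times>\<times> ?H"
    by (rule group.iso_sym[OF DirProd_group[OF group_subgroup_generated group_subgroup_generated]])
  have carrH: "carrier ?H = H"
    by (rule BG.carrier_subgroup_generated_subgroup)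
  have ord1: "ord a \<ge> 1"
    using ord_ge_1[OF less.prems(2) a] .
  have "\<exists>ns. (\<forall>n\<in>set ns. n \<ge> 1) \<and> ?H \<cong> add_monoid (cyclic_sum ns)"
  proof (cases "H = carrier G")
    case True
    then have "a \<in> generate G {a} \<inter> H"
      using a generate.incl[of a "{a}" G] by simp
    then have "a = \<one>\<^bsub>G\<^esub>"
      unfolding H(2) by simp
    then have "x = \<one>\<^bsub>G\<^esub>" if "x \<in> carrier G" for x
      using bspec[OF exp that] ord_eq_1[OF that] by simp
    then have "carrier ?H = {\<one>\<^bsub>G\<^esub>}"
      unfolding carrH using True by auto
    moreover have "carrier (add_monoid (cyclic_sum [])) = {[]}"
      by (simp add: cyclic_sum_def)
    ultimately have "?H \<cong> add_monoid (cyclic_sum [])"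
      by (rule singleton_groups_iso[OF group_subgroup_generated add_group_cyclic_sum])
    then show ?thesis
      by (intro exI[of _ "[]"]) simp
  next
    case False
    then have "card H < card (carrier G)"
      using BG.subset less.prems(2) by (intro psubset_card_mono) auto
    moreover have "comm_group ?H"
      by (rule abelian_subgroup_generated[OF less.prems(1)])
    moreover have "finite H"
      using BG.subset less.prems(2) by (rule finite_subset)
    ultimately show ?thesis
      using less.hyps[of ?H] unfolding carrH by meson
  qed
  then obtain ns where ns: "\<forall>n\<in>set ns. n \<ge> 1" "?H \<cong> add_monoid (cyclic_sum ns)"
    by blast
  have "?A \<times>\<times> ?H \<cong> add_monoid (ZFact (int (ord a))) \<times>\<times> add_monoid (cyclic_sum ns)"
    by (rule group.DirProd_iso_trans[OF group_subgroup_generated cyclic_subgroup_iso_ZFact[OF a] ns(2)])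
  then have "G \<cong> add_monoid (cyclic_sum (ord a # ns))"
    by (rule iso_trans[OF iso_trans[OF G_iso] cyclic_sum_Cons_add_iso])
  then show ?case
    using ns(1) ord1 by (intro exI[of _ "ord a # ns"]) simp
qed

section \<open>Exponents of groups\<close>

text \<open>
  The exponent of a group, described by the exponents that annihilate it rather than as a least
  one. In this form it is visibly invariant under isomorphism and turns direct products into
  least common multiples.
\<close>

definition has_exponent :: "('a, 'b) monoid_scheme \<Rightarrow> nat \<Rightarrow> bool" where
  "has_exponent G e \<longleftrightarrow> (\<forall>m::nat. (\<forall>x\<in>carrier G. x [^]\<^bsub>G\<^esub> m = \<one>\<^bsub>G\<^esub>) \<longleftrightarrow> e dvd m)"

lemma has_exponent_unique:
  assumes "has_exponent G d" "has_exponent G e"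
  shows "d = e"
proof (rule dvd_antisym)
  show "d dvd e" "e dvd d"
    using assms unfolding has_exponent_def by (metis dvd_refl)+
qed

lemma has_exponent_iso:
  assumes "group G" "group H" "G \<cong> H" "has_exponent G e"
  shows "has_exponent H e"
proof -
  obtain h where h: "h \<in> hom G H" "inj_on h (carrier G)" "h ` carrier G = carrier H"
    using assms(3) by (auto simp: is_iso_def iso_def bij_betw_def)
  interpret group_hom G H h
    using assms h by (simp add: group_hom_def group_hom_axioms_def)
  have "(\<forall>y\<in>carrier H. y [^]\<^bsub>H\<^esub> m = \<one>\<^bsub>H\<^esub>) \<longleftrightarrow> (\<forall>x\<in>carrier G. x [^]\<^bsub>G\<^esub> m = \<one>\<^bsub>G\<^esub>)" for m :: nat
  proof -
    have "(\<forall>y\<in>carrier H. y [^]\<^bsub>H\<^esub> m = \<one>\<^bsub>H\<^esub>) \<longleftrightarrow> (\<forall>x\<in>carrier G. h (x [^]\<^bsub>G\<^esub> m) = h \<one>\<^bsub>G\<^esub>)"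
      unfolding h(3)[symmetric] by (simp add: hom_nat_pow)
    also have "\<dots> \<longleftrightarrow> (\<forall>x\<in>carrier G. x [^]\<^bsub>G\<^esub> m = \<one>\<^bsub>G\<^esub>)"
      by (intro ball_cong inj_on_eq_iff[OF h(2)]) simp_all
    finally show ?thesis .
  qed
  then show ?thesis
    using assms(4) by (simp add: has_exponent_def)
qed

lemma has_exponent_singleton:
  assumes "group G" "carrier G = {x}"
  shows "has_exponent G 1"
proof -
  interpret group G by fact
  have "y = \<one>\<^bsub>G\<^esub>" if "y \<in> carrier G" for y
    using that one_closed unfolding assms(2) by simp
  then have "y [^]\<^bsub>G\<^esub> m = \<one>\<^bsub>G\<^esub>" if "y \<in> carrier G" for y and m :: nat
    using nat_pow_closed[OF that] by blast
  then show ?thesis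
    by (simp add: has_exponent_def)
qed

lemma DirProd_nat_pow: "(x, y) [^]\<^bsub>G \<times>\<times> H\<^esub> (m::nat) = (x [^]\<^bsub>G\<^esub> m, y [^]\<^bsub>H\<^esub> m)"
  by (induction m) (auto simp: nat_pow_def)

lemma has_exponent_DirProd:
  assumes "group G" "group H" "has_exponent G d" "has_exponent H e"
  shows "has_exponent (G \<times>\<times> H) (lcm d e)"
proof -
  have "carrier G \<noteq> {}" "carrier H \<noteq> {}"
    using assms(1,2) by (auto dest: group.is_monoid monoid.one_closed)
  then have "(\<forall>z\<in>carrier (G \<times>\<times> H). z [^]\<^bsub>G \<times>\<times> H\<^esub> m = \<one>\<^bsub>G \<times>\<times> H\<^esub>) \<longleftrightarrow>
      (\<forall>x\<in>carrier G. x [^]\<^bsub>G\<^esub> m = \<one>\<^bsub>G\<^esub>) \<and> (\<forall>y\<in>carrier H. y [^]\<^bsub>H\<^esub> m = \<one>\<^bsub>H\<^esub>)" for m :: nat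
    by (auto simp: DirProd_nat_pow)
  then show ?thesis
    using assms(3,4) by (simp add: has_exponent_def)
qed

section \<open>Carmichael's function on least common multiples\<close>

text \<open>
  Carmichael's function is the exponent of the group of units modulo \<open>n\<close>.
\<close>

lemma Carmichael_dvd_iff:
  assumes "n > 0"
  shows "Carmichael n dvd m \<longleftrightarrow> (\<forall>a. coprime n a \<longrightarrow> [a ^ m = 1] (mod n))"
proof
  assume "Carmichael n dvd m"
  then show "\<forall>a. coprime n a \<longrightarrow> [a ^ m = 1] (mod n)"
    using Carmichael_divides by blast
next
  assume *: "\<forall>a. coprime n a \<longrightarrow> [a ^ m = 1] (mod n)"
  have "ord n a dvd m" if "a \<in> totatives n" for a
    using * that unfolding ord_divides[symmetric] totatives_def by (simp add: coprime_commute)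
  then show "Carmichael n dvd m"
    unfolding Carmichael_def by (intro Lcm_least) auto
qed

lemma Carmichael_dvd_mult_prime:
  assumes "n > 0" "Factorial_Ring.prime p"
  shows "Carmichael n dvd Carmichael (n * p)"
proof (cases "p dvd n")
  case True
  \<comment> \<open>The same numbers are coprime to \<open>n * p\<close> as to \<open>n\<close>.\<close>
  have "[a ^ Carmichael (n * p) = 1] (mod n)" if "coprime n a" for a
  proof -
    have "coprime p a"
      using coprime_divisors[OF True dvd_refl that] .
    then have "[a ^ Carmichael (n * p) = 1] (mod (n * p))"
      using that by (intro Carmichael_divides) auto
    then show ?thesis
      by (rule cong_dvd_modulus_nat) simp
  qed
  then show ?thesis
    using assms by (simp add: Carmichael_dvd_iff)
next
  case False
  then have "coprime n p"
    using assms prime_imp_coprime coprime_commute by metis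
  then show ?thesis
    using assms prime_gt_1_nat[of p] by (cases "n = 1") (simp, intro Carmichael_dvd_mono_coprime, auto)
qed

text \<open>
  Units modulo \<open>m\<close> lift to units modulo any multiple of \<open>m\<close>. Passing to the multiple one prime at
  a time replaces this lifting by two easy cases: either the prime already divides the modulus, and
  coprimality does not change, or it is coprime to the modulus.
\<close>

lemma Carmichael_dvd_mono:
  assumes "m > 0" "m dvd n" "n > 0"
  shows "Carmichael m dvd Carmichael n"
proof -
  obtain q where q: "n = m * q"
    using assms(2) ..
  then have "q > 0"
    using assms(3) by auto
  then have "Carmichael m dvd Carmichael (m * q)"
  proof (induction q rule: prime_divisors_induct)
    case (factor p q)
    then have "Carmichael m dvd Carmichael (m * q)"
      by simp
    also have "\<dots> dvd Carmichael (m * q * p)"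
      using factor assms(1) by (intro Carmichael_dvd_mult_prime) auto
    finally show ?case
      by (simp add: mult_ac)
  qed simp_all
  then show ?thesis
    by (simp add: q)
qed

text \<open>
  Being \<open>1\<close> modulo \<open>lcm m n\<close> means being \<open>1\<close> modulo both; the converse divisibility is
  monotonicity. The general case is essential: the moduli of a decomposition usually share prime
  factors.
\<close>

lemma Carmichael_lcm:
  assumes "m > 0" "n > 0"
  shows "Carmichael (lcm m n) = lcm (Carmichael m) (Carmichael n)"
proof (rule dvd_antisym)
  let ?L = "lcm (Carmichael m) (Carmichael n)"
  have pos: "lcm m n > 0"
    using assms by (simp add: lcm_pos_nat)
  have "[a ^ ?L = 1] (mod lcm m n)" if a: "coprime (lcm m n) a" for a
  proof -
    have "coprime m a" "coprime n a"
      using a by (meson coprime_divisors dvd_lcm1 dvd_lcm2 dvd_refl)+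
    then have "[a ^ ?L = 1] (mod m)" "[a ^ ?L = 1] (mod n)"
      by (intro Carmichael_divides; simp)+
    then show ?thesis
      by (rule cong_cong_lcm_nat)
  qed
  then show "Carmichael (lcm m n) dvd ?L"
    using pos by (simp add: Carmichael_dvd_iff)
  show "?L dvd Carmichael (lcm m n)"
    using assms pos by (intro lcm_least Carmichael_dvd_mono) auto
qed

section \<open>Exponents of residue rings\<close>

lemma add_ZMod_pow: "ZMod k x [^]\<^bsub>add_monoid (ZFact k)\<^esub> (m::nat) = ZMod k (int m * x)"
  by (induction m) (simp_all add: nat_pow_def ZMod_zero ZMod_add algebra_simps)

lemma ZMod_pow: "ZMod k x [^]\<^bsub>ZFact k\<^esub> (m::nat) = ZMod k (x ^ m)"
  by (induction m) (simp_all add: nat_pow_def ZMod_one ZMod_mult algebra_simps)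

lemma has_exponent_add_ZFact: "has_exponent (add_monoid (ZFact (int n))) n"
proof -
  have "(\<forall>x. int n dvd int m * x) \<longleftrightarrow> n dvd m" for m
    by (metis dvd_mult2 int_dvd_int_iff mult.right_neutral)
  moreover have "x [^]\<^bsub>add_monoid (ZFact (int n))\<^esub> m = \<zero>\<^bsub>ZFact (int n)\<^esub> \<longleftrightarrow> int n dvd int m * y"
    if "x = ZMod (int n) y" for x y m
    unfolding that add_ZMod_pow unfolding ZMod_zero ZMod_eq_mod by (simp add: dvd_eq_mod_eq_0)
  ultimately show ?thesis
    by (simp add: has_exponent_def carrier_ZFact)
qed

lemma Units_ZFact: "Units (ZFact (int n)) = ZMod (int n) ` {x. coprime (int n) x}"
proof -
  have "ZMod (int n) x \<in> Units (ZFact (int n)) \<longleftrightarrow> (\<exists>y. [x * y = 1] (mod int n))" for x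
    by (auto simp: Units_def carrier_ZFact ZMod_mult ZMod_one ZMod_eq_mod cong_def mult.commute)
  also have "\<dots> x \<longleftrightarrow> coprime (int n) x" for x
    by (subst coprime_commute) (simp add: coprime_iff_invertible_int)
  finally have "ZMod (int n) x \<in> Units (ZFact (int n)) \<longleftrightarrow> coprime (int n) x" for x .
  moreover have "Units (ZFact (int n)) \<subseteq> range (ZMod (int n))"
    by (auto simp: Units_def carrier_ZFact)
  ultimately show ?thesis
    by auto
qed

lemma has_exponent_units_ZFact:
  assumes "n > 0"
  shows "has_exponent (units_of (ZFact (int n))) (Carmichael n)"
proof -
  interpret cring "ZFact (int n)"
    by (rule ZFact_is_cring)
  have "(\<forall>u\<in>Units (ZFact (int n)). u [^]\<^bsub>units_of (ZFact (int n))\<^esub> m = \<one>\<^bsub>ZFact (int n)\<^esub>) \<longleftrightarrow>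
      (\<forall>x. coprime (int n) x \<longrightarrow> [x ^ m = 1] (mod int n))" for m :: nat
  proof -
    have "(\<forall>u\<in>Units (ZFact (int n)). u [^]\<^bsub>units_of (ZFact (int n))\<^esub> m = \<one>\<^bsub>ZFact (int n)\<^esub>) \<longleftrightarrow>
        (\<forall>u\<in>Units (ZFact (int n)). u [^]\<^bsub>ZFact (int n)\<^esub> m = \<one>\<^bsub>ZFact (int n)\<^esub>)"
      by (simp add: units_of_pow)
    also have "\<dots> \<longleftrightarrow> (\<forall>x. coprime (int n) x \<longrightarrow> [x ^ m = 1] (mod int n))"
      by (simp add: Units_ZFact ZMod_pow ZMod_one ZMod_eq_mod cong_def)
    finally show ?thesis .
  qed
  moreover have "(\<forall>x. coprime (int n) x \<longrightarrow> [x ^ m = 1] (mod int n)) \<longleftrightarrow>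
      (\<forall>a. coprime n a \<longrightarrow> [a ^ m = 1] (mod n))" for m
  proof (intro iffI allI impI)
    fix a assume *: "\<forall>x. coprime (int n) x \<longrightarrow> [x ^ m = 1] (mod int n)" and "coprime n a"
    then have "[int a ^ m = 1] (mod int n)"
      by simp
    then show "[a ^ m = 1] (mod n)"
      by (metis cong_int_iff of_nat_1 of_nat_power)
  next
    fix x assume *: "\<forall>a. coprime n a \<longrightarrow> [a ^ m = 1] (mod n)" and x: "coprime (int n) x"
    define a where "a = nat (x mod int n)"
    have a: "int a = x mod int n"
      using assms by (simp add: a_def)
    have "coprime n a"
      using x assms by (metis a coprime_int_iff coprime_mod_right_iff of_nat_0_less_iff less_irrefl)
    then have "[a ^ m = 1] (mod n)"
      using * by blast
    then have "[int a ^ m = 1] (mod int n)"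
      by (metis cong_int_iff of_nat_1 of_nat_power)
    moreover have "[int a ^ m = x ^ m] (mod int n)"
      by (intro cong_pow) (simp add: a cong_def)
    ultimately show "[x ^ m = 1] (mod int n)"
      using cong_trans cong_sym by blast
  qed
  ultimately show ?thesis
    using assms by (simp add: has_exponent_def units_of_carrier units_of_one Carmichael_dvd_iff)
qed

section \<open>Iterated unit rings and Carmichael's function\<close>

lemma ring_hom_Units:
  assumes "h \<in> ring_hom R S" "u \<in> Units R"
  shows "h u \<in> Units S"
proof -
  obtain v where v: "u \<in> carrier R" "v \<in> carrier R" "v \<otimes>\<^bsub>R\<^esub> u = \<one>\<^bsub>R\<^esub>" "u \<otimes>\<^bsub>R\<^esub> v = \<one>\<^bsub>R\<^esub>"
    using assms(2) by (auto simp: Units_def)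
  have "h v \<otimes>\<^bsub>S\<^esub> h u = \<one>\<^bsub>S\<^esub>" "h u \<otimes>\<^bsub>S\<^esub> h v = \<one>\<^bsub>S\<^esub>"
    using ring_hom_mult[OF assms(1) v(2,1)] ring_hom_mult[OF assms(1) v(1,2)]
      ring_hom_one[OF assms(1)] v(3,4) by simp_all
  then show ?thesis
    using ring_hom_closed[OF assms(1) v(1)] ring_hom_closed[OF assms(1) v(2)]
    by (auto simp: Units_def)
qed

lemma ring_iso_imp_units_iso:
  assumes "ring R" "h \<in> ring_iso R S"
  shows "units_of R \<cong> units_of S"
proof (rule is_isoI, rule isoI)
  have h: "h \<in> ring_hom R S" "bij_betw h (carrier R) (carrier S)"
    using assms(2) by (auto simp: ring_iso_def)
  have inv: "inv_into (carrier R) h \<in> ring_hom S R"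
    using ring_iso_set_sym[OF assms] by (simp add: ring_iso_def)
  have sub: "Units R \<subseteq> carrier R" "Units S \<subseteq> carrier S"
    by (auto simp: Units_def)
  show "h \<in> hom (units_of R) (units_of S)"
    using sub(1) by (auto simp: hom_def units_of_carrier units_of_mult
        intro: ring_hom_Units[OF h(1)] ring_hom_mult[OF h(1)])
  have "h ` Units R = Units S"
  proof (intro equalityI subsetI)
    fix y assume y: "y \<in> Units S"
    then have "h (inv_into (carrier R) h y) = y"
      using sub(2) bij_betw_inv_into_right[OF h(2)] by blast
    then show "y \<in> h ` Units R"
      using ring_hom_Units[OF inv y] by (metis imageI)
  qed (auto intro: ring_hom_Units[OF h(1)])
  then show "bij_betw h (carrier (units_of R)) (carrier (units_of S))"
    using h(2) sub(1) by (auto simp: bij_betw_def units_of_carrier intro: inj_on_subset)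
qed

lemma units_of_RDirProd: "units_of (RDirProd R S) = units_of R \<times>\<times> units_of S"
proof -
  have "Units (RDirProd R S) = Units R \<times> Units S"
    by (auto simp: Units_def RDirProd_def DirProd_def monoid.defs)
  then show ?thesis
    by (simp add: units_of_def RDirProd_def DirProd_def monoid.defs)
qed

lemma finite_carrier_ZFact:
  assumes "n > 0"
  shows "finite (carrier (ZFact (int n)))"
proof -
  have "carrier (ZFact (int n)) \<subseteq> ZMod (int n) ` {0..<int n}"
  proof
    fix c assume "c \<in> carrier (ZFact (int n))"
    then obtain x where "c = ZMod (int n) (x mod int n)"
      using ZMod_mod by (auto simp: carrier_ZFact)
    then show "c \<in> ZMod (int n) ` {0..<int n}"
      using assms by (intro image_eqI[of _ _ "x mod int n"]) simp_all
  qed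
  then show ?thesis
    by (rule finite_subset) simp
qed

text \<open>
  The invariant that survives the passage to the units. A finite direct sum of rings
  \<open>\<int>\<^sub>n\<close> satisfies it with \<open>e\<close> the least common multiple of the moduli. Beyond
  commutativity and finiteness it speaks of exponents of groups, so it does not depend on how a
  ring is decomposed.
\<close>

definition carmichael_ring :: "('a, 'b) ring_scheme \<Rightarrow> nat \<Rightarrow> bool" where
  "carmichael_ring R e \<longleftrightarrow> cring R \<and> finite (carrier R) \<and> e > 0 \<and>
     has_exponent (add_monoid R) e \<and> has_exponent (units_of R) (Carmichael e)"

lemma carmichael_ring_ZFact: "n > 0 \<Longrightarrow> carmichael_ring (ZFact (int n)) n"
  by (simp only: carmichael_ring_def ZFact_is_cring finite_carrier_ZFact has_exponent_add_ZFact
      has_exponent_units_ZFact simp_thms)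

lemma cring_groups:
  assumes "cring R"
  shows "group (add_monoid R)" "comm_group (units_of R)" "group (units_of R)"
proof -
  interpret cring R by fact
  show "group (add_monoid R)"
    by (rule a_group)
  show "comm_group (units_of R)" "group (units_of R)"
    by (rule units_comm_group, rule units_group)
qed

lemma carmichael_ring_RDirProd:
  assumes R: "carmichael_ring R d" and S: "carmichael_ring S e"
  shows "carmichael_ring (RDirProd R S) (lcm d e)"
proof -
  have cr: "cring R" "cring S"
    using assms by (simp_all only: carmichael_ring_def)
  have "has_exponent (add_monoid (RDirProd R S)) (lcm d e)"
    unfolding RDirProd_add_monoid using R S
    by (intro has_exponent_DirProd cring_groups cr) (simp_all only: carmichael_ring_def)
  moreover have "has_exponent (units_of (RDirProd R S)) (lcm (Carmichael d) (Carmichael e))"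
    unfolding units_of_RDirProd using R S
    by (intro has_exponent_DirProd cring_groups cr) (simp_all only: carmichael_ring_def)
  moreover have "cring (RDirProd R S)"
    by (rule cring_RDirProd[OF cr])
  moreover have "finite (carrier (RDirProd R S))"
    using R S by (simp only: carmichael_ring_def RDirProd_carrier finite_cartesian_product)
  moreover have "d > 0" "e > 0"
    using R S by (simp_all only: carmichael_ring_def)
  ultimately show ?thesis
    by (simp only: carmichael_ring_def Carmichael_lcm lcm_pos_nat simp_thms)
qed

lemma carmichael_ring_iso:
  assumes "carmichael_ring R e" "h \<in> ring_iso R S" "cring S"
  shows "carmichael_ring S e"
proof -
  have R: "cring R" "finite (carrier R)" "e > 0" "has_exponent (add_monoid R) e"
    "has_exponent (units_of R) (Carmichael e)"
    using assms(1) by (simp_all only: carmichael_ring_def)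
  have "has_exponent (add_monoid S) e"
    by (rule has_exponent_iso[OF cring_groups(1)[OF R(1)] cring_groups(1)[OF assms(3)]
          is_isoI[OF ring_iso_imp_add_iso[OF assms(2)]] R(4)])
  moreover have "has_exponent (units_of S) (Carmichael e)"
    by (rule has_exponent_iso[OF cring_groups(3)[OF R(1)] cring_groups(3)[OF assms(3)]
          ring_iso_imp_units_iso[OF cring.axioms(1)[OF R(1)] assms(2)] R(5)])
  moreover have "finite (carrier S)"
    using R(2) bij_betw_finite[OF ring_iso_memE(5)[OF assms(2)]] by simp
  ultimately show ?thesis
    using R(3) assms(3) by (simp only: carmichael_ring_def simp_thms)
qed

lemma carmichael_ring_cyclic_sum:
  assumes "\<forall>n\<in>set ns. n \<ge> 1"
  shows "\<exists>e. carmichael_ring (cyclic_sum ns) e"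
  using assms
proof (induction ns)
  case Nil
  interpret cring "cyclic_sum []"
    by (rule cring_cyclic_sum)
  have carr: "carrier (cyclic_sum []) = {[]}"
    by (simp add: cyclic_sum_def)
  have "Units (cyclic_sum []) \<subseteq> {[]}"
    using Units_closed[THEN subsetI] unfolding carr .
  moreover have "Units (cyclic_sum []) \<noteq> {}"
    using Units_one_closed by (simp only: ex_in_conv[symmetric]) (rule exI)
  ultimately have "carrier (units_of (cyclic_sum [])) = {[]}"
    unfolding units_of_carrier by (simp only: subset_singleton_iff simp_thms)
  then have "has_exponent (units_of (cyclic_sum [])) 1"
    by (rule has_exponent_singleton[OF units_group])
  moreover have "has_exponent (add_monoid (cyclic_sum [])) 1"
    by (rule has_exponent_singleton[OF a_group]) (simp add: carr)
  ultimately have "carmichael_ring (cyclic_sum []) 1"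
    by (simp only: carmichael_ring_def carr cring_axioms Carmichael_1) simp
  then show ?case ..
next
  case (Cons n ns)
  then obtain e where e: "carmichael_ring (cyclic_sum ns) e"
    by auto
  have "carmichael_ring (ZFact (int n)) n"
    using Cons.prems by (intro carmichael_ring_ZFact) simp
  from carmichael_ring_iso[OF carmichael_ring_RDirProd[OF this e] cyclic_sum_Cons_iso cring_cyclic_sum]
  show ?case ..
qed

text \<open>
  The chosen decomposition is by definition an isomorphism for the additive structures, and the
  multiplication was transported so as to make it a ring isomorphism. The ring axioms for the
  ring of units then come from the direct sum.
\<close>

lemma units_ring_iso_cyclic_sum:
  assumes "cring R" "finite (carrier R)"
  obtains ns \<psi> where "\<forall>n\<in>set ns. n \<ge> 1" "\<psi> \<in> ring_iso (cyclic_sum ns) (units_ring R)" "cring (units_ring R)"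
proof -
  interpret R: cring R by fact
  have "finite (carrier (units_of R))"
    unfolding units_of_carrier using assms(2) by (rule rev_finite_subset) (rule R.Units_closed[THEN subsetI])
  then obtain ns' where "ns' \<noteq> []" "\<forall>n\<in>set ns'. n \<ge> 1" "units_of R \<cong> add_monoid (cyclic_sum ns')"
    using finite_comm_group_iso_cyclic_sum[OF R.units_comm_group] by meson
  then obtain \<phi>' where "unit_decomposition R (ns', \<phi>')"
    by (auto simp: unit_decomposition_def is_iso_def)
  then have some: "unit_decomposition R (SOME d. unit_decomposition R d)"
    by (rule someI)
  obtain ns \<phi> where d: "(SOME d. unit_decomposition R d) = (ns, \<phi>)"
    by (meson surj_pair)
  let ?C = "cyclic_sum ns"
  interpret C: cring ?C
    by (rule cring_cyclic_sum)
  define \<psi> where "\<psi> = inv_into (Units R) \<phi>"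
  have ns: "\<forall>n\<in>set ns. n \<ge> 1" and \<phi>: "\<phi> \<in> iso (units_of R) (add_monoid ?C)"
    using some unfolding d by (simp_all add: unit_decomposition_def)
  have bij: "bij_betw \<phi> (Units R) (carrier ?C)"
    using \<phi> by (simp add: iso_def units_of_carrier)
  have \<phi>_mult: "\<phi> (x \<otimes>\<^bsub>R\<^esub> y) = \<phi> x \<oplus>\<^bsub>?C\<^esub> \<phi> y" if "x \<in> Units R" "y \<in> Units R" for x y
    using \<phi> that by (simp add: iso_def hom_def units_of_carrier units_of_mult)
  have bij': "bij_betw \<psi> (carrier ?C) (Units R)"
    unfolding \<psi>_def using bij by (rule bij_betw_inv_into)
  have \<phi>\<psi>: "\<phi> (\<psi> c) = c" if "c \<in> carrier ?C" for c
    unfolding \<psi>_def using bij that by (rule bij_betw_inv_into_right)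
  have \<psi>\<phi>: "\<psi> (\<phi> x) = x" if "x \<in> Units R" for x
    unfolding \<psi>_def using bij that by (rule bij_betw_inv_into_left)
  have \<psi>_Units: "\<psi> c \<in> Units R" if "c \<in> carrier ?C" for c
    using bij_betw_apply[OF bij' that] .
  have eq: "units_ring R = \<lparr>carrier = Units R, monoid.mult = (\<lambda>x y. \<psi> (\<phi> x \<otimes>\<^bsub>?C\<^esub> \<phi> y)),
      one = \<psi> \<one>\<^bsub>?C\<^esub>, ring.zero = \<one>\<^bsub>R\<^esub>, ring.add = monoid.mult R\<rparr>"
    unfolding units_ring_def d Let_def prod.case \<psi>_def ..
  have iso: "\<psi> \<in> ring_iso ?C (units_ring R)"
  proof (rule ring_iso_memI)
    fix c c' assume c: "c \<in> carrier ?C" "c' \<in> carrier ?C"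
    have "\<psi> (c \<oplus>\<^bsub>?C\<^esub> c') = \<psi> (\<phi> (\<psi> c \<otimes>\<^bsub>R\<^esub> \<psi> c'))"
      using c by (simp add: \<phi>_mult \<psi>_Units \<phi>\<psi>)
    also have "\<dots> = \<psi> c \<otimes>\<^bsub>R\<^esub> \<psi> c'"
      using c by (intro \<psi>\<phi> R.Units_m_closed \<psi>_Units)
    finally show "\<psi> (c \<oplus>\<^bsub>?C\<^esub> c') = \<psi> c \<oplus>\<^bsub>units_ring R\<^esub> \<psi> c'"
      by (simp add: eq)
  qed (simp_all add: eq \<phi>\<psi> \<psi>_Units bij')
  have "\<phi> \<one>\<^bsub>R\<^esub> = \<zero>\<^bsub>?C\<^esub>"
    using \<phi> hom_one[of \<phi> "units_of R" "add_monoid ?C"] R.units_group C.a_group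
    by (simp add: iso_def units_of_one)
  then have "\<psi> \<zero>\<^bsub>?C\<^esub> = \<zero>\<^bsub>units_ring R\<^esub>"
    using \<psi>\<phi>[OF R.Units_one_closed] by (simp add: eq)
  then have "cring (units_ring R)"
    using C.ring_iso_imp_img_cring[OF iso] by simp
  then show thesis
    using that[OF ns iso] by blast
qed

lemma add_monoid_units_ring: "add_monoid (units_ring R) = units_of R"
  by (simp add: units_ring_def units_of_def Let_def split: prod.split)

text \<open>
  The additive group of the ring of units is the group of units, so its exponent is already known
  to be \<open>Carmichael e\<close>. The ring of units is moreover isomorphic to some direct sum of rings
  \<open>\<int>\<^sub>n\<close>, hence satisfies the invariant for some number; since exponents are unique, that number is
  \<open>Carmichael e\<close>, whichever decomposition was chosen.
\<close>

theorem carmichael_ring_units_ring: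
  assumes "carmichael_ring R e"
  shows "carmichael_ring (units_ring R) (Carmichael e)"
proof -
  have R: "cring R" "finite (carrier R)" "has_exponent (units_of R) (Carmichael e)"
    using assms by (simp_all only: carmichael_ring_def)
  obtain ns \<psi> where ns: "\<forall>n\<in>set ns. n \<ge> 1" and iso: "\<psi> \<in> ring_iso (cyclic_sum ns) (units_ring R)"
    and cr: "cring (units_ring R)"
    using units_ring_iso_cyclic_sum[OF R(1,2)] .
  obtain e' where "carmichael_ring (cyclic_sum ns) e'"
    using carmichael_ring_cyclic_sum[OF ns] ..
  then have e': "carmichael_ring (units_ring R) e'"
    using iso cr by (rule carmichael_ring_iso)
  then have "has_exponent (units_of R) e'"
    by (simp only: carmichael_ring_def add_monoid_units_ring)
  then have "e' = Carmichael e"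
    using R(3) by (rule has_exponent_unique)
  then show ?thesis
    using e' by simp
qed

corollary carmichael_ring_gen_units:
  assumes "carmichael_ring R e"
  shows "carmichael_ring (gen_units k R) ((Carmichael ^^ k) e)"
  using assms by (induction k) (auto intro: carmichael_ring_units_ring)

lemma carmichael_ring_trivial_iff:
  assumes "carmichael_ring R e"
  shows "card (carrier R) = 1 \<longleftrightarrow> e = 1"
proof -
  interpret cring R
    using assms by (simp only: carmichael_ring_def)
  have "has_exponent (add_monoid R) e"
    using assms by (simp only: carmichael_ring_def)
  then have "(\<forall>x\<in>carrier (add_monoid R). x [^]\<^bsub>add_monoid R\<^esub> (1::nat) = \<one>\<^bsub>add_monoid R\<^esub>) \<longleftrightarrow> e dvd 1"
    unfolding has_exponent_def by (rule spec)
  moreover have "x [^]\<^bsub>add_monoid R\<^esub> (1::nat) = x" if "x \<in> carrier R" for x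
    by (rule monoid.nat_pow_eone[OF group.is_monoid[OF a_group]]) (simp add: that)
  ultimately have "(\<forall>x\<in>carrier R. x = \<zero>\<^bsub>R\<^esub>) \<longleftrightarrow> e dvd 1"
    by (simp only: partial_object.select_convs monoid.select_convs cong: ball_cong)
  moreover have "card (carrier R) = 1 \<longleftrightarrow> (\<forall>x\<in>carrier R. x = \<zero>\<^bsub>R\<^esub>)"
  proof
    assume "card (carrier R) = 1"
    then obtain z where "carrier R = {z}"
      by (rule card_1_singletonE)
    then show "\<forall>x\<in>carrier R. x = \<zero>\<^bsub>R\<^esub>"
      using zero_closed by simp
  next
    assume "\<forall>x\<in>carrier R. x = \<zero>\<^bsub>R\<^esub>"
    then have "carrier R = {\<zero>\<^bsub>R\<^esub>}"
      using zero_closed by auto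
    then show "card (carrier R) = 1"
      by simp
  qed
  ultimately show ?thesis
    by simp
qed

section \<open>Iterates of Carmichael's function at odd prime powers\<close>

lemma Carmichael_funpow_1: "(Carmichael ^^ k) 1 = 1"
  by (induction k) simp_all

lemma Carmichael_funpow_pos: "n > 0 \<Longrightarrow> (Carmichael ^^ k) n > 0"
  by (induction k) simp_all

lemma Carmichael_funpow_lcm:
  assumes "m > 0" "n > 0"
  shows "(Carmichael ^^ k) (lcm m n) = lcm ((Carmichael ^^ k) m) ((Carmichael ^^ k) n)"
  using assms by (induction k) (simp_all add: Carmichael_lcm Carmichael_funpow_pos)

text \<open>
  Since \<open>Carmichael (p ^ (a + 1)) = lcm (p ^ a) (p - 1)\<close> and \<open>Carmichael p = p - 1\<close>, the \<open>k\<close>-th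
  iterate at \<open>p ^ (a + 1)\<close> is \<open>1\<close> if and only if the \<open>(k - 1)\<close>-st iterate at \<open>p ^ a\<close> and the
  \<open>k\<close>-th iterate at \<open>p\<close> are both \<open>1\<close>. By induction the first condition says that an earlier
  iterate at \<open>p\<close> is \<open>1\<close>, and \<open>1\<close> is a fixed point, so the second condition follows from it.
\<close>

lemma Carmichael_funpow_prime_power:
  fixes p :: nat
  assumes p: "Factorial_Ring.prime p" "odd p" and "a \<ge> 1" "k \<ge> 1"
  shows "(Carmichael ^^ k) (p ^ a) = 1 \<longleftrightarrow> a < k \<and> (Carmichael ^^ (k - a + 1)) p = 1"
  using assms(3,4)
proof (induction a arbitrary: k rule: dec_induct)
  case base
  have "p - 1 \<noteq> 1"
    using p by (metis even_numeral dvd_refl Suc_1 diff_Suc_1 prime_gt_1_nat Suc_pred prime_gt_0_nat One_nat_def)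
  \<comment> \<open>Oddness of \<open>p\<close> makes the first iterate \<open>p - 1\<close> different from \<open>1\<close>, hence the strict \<open>a < k\<close>.\<close>
  then have "k \<noteq> 1" if "(Carmichael ^^ k) p = 1"
    using that p by (auto simp: Carmichael_prime)
  then show ?case
    using base by auto
next
  case (step a)
  have p1: "p > 2"
    using p prime_ge_2_nat[of p] by (cases "p = 2") auto
  obtain j where j: "k = Suc j"
    using step.prems by (cases k) auto
  have "coprime p (p - 1)"
    using coprime_diff_one_left_nat[of p] p1 by (simp add: coprime_commute)
  then have "coprime (p ^ a) (p - 1)"
    by simp
  then have lcm: "Carmichael (p ^ Suc a) = lcm (p ^ a) (p - 1)"
    using p Carmichael_odd_prime_power[of p "Suc a"] by (simp add: lcm_coprime)
  have *: "(Carmichael ^^ k) (p ^ Suc a) = lcm ((Carmichael ^^ j) (p ^ a)) ((Carmichael ^^ k) p)"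
    unfolding j funpow_Suc_right o_def lcm Carmichael_prime[OF p(1)]
    using p1 by (intro Carmichael_funpow_lcm) auto
  show ?case
  proof (cases "j = 0")
    case True
    then show ?thesis
      using * p1 step.hyps by (auto simp: j)
  next
    case False
    have "(Carmichael ^^ k) p = 1" if "a < j" "(Carmichael ^^ (j - a + 1)) p = 1"
    proof -
      have "k = a + (j - a + 1)"
        using that(1) by (simp add: j)
      then show ?thesis
        using that(2) Carmichael_funpow_1[of a] by (simp only: funpow_add o_apply)
    qed
    then show ?thesis
      using * step.IH[of j] False by (auto simp: j lcm_eq_1_iff)
  qed
qed

section \<open>Trivial generalized groups of units\<close>

lemma iso_ZFact_1:
  assumes "card (carrier R) = 1"
  shows "R \<simeq> ZFact 1"
proof -
  obtain x where x: "carrier R = {x}"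
    using assms card_1_singletonE by blast
  interpret Z: cring "ZFact 1"
    by (rule ZFact_is_cring)
  have all: "c = UNIV" if "c \<in> carrier (ZFact 1)" for c
    using that by (simp add: ZFact_one)
  have "(\<lambda>_. UNIV) \<in> ring_iso R (ZFact 1)"
    using all[OF Z.one_closed] all[OF Z.m_closed] all[OF Z.a_closed]
    by (intro ring_iso_memI) (auto simp: x ZFact_one bij_betw_def)
  then show ?thesis
    by (auto simp: is_ring_iso_def)
qed

theorem theorem10:
  fixes p k \<alpha> :: nat
  assumes "Factorial_Ring.prime p" and "odd p" and "k \<ge> 1" and "\<alpha> \<ge> 1"
  shows "card (carrier (gen_units k (ZFact (int (p ^ \<alpha>))))) = 1 \<longleftrightarrow>
         \<alpha> < k \<and> gen_units (k - \<alpha> + 1) (ZFact (int p)) \<simeq> ZFact 1"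
proof -
  have p0: "p > 0"
    using assms(1) by (rule prime_gt_0_nat)
  have trivial: "card (carrier (gen_units j (ZFact (int n)))) = 1 \<longleftrightarrow> (Carmichael ^^ j) n = 1"
    if "n > 0" for j n
    by (intro carmichael_ring_trivial_iff carmichael_ring_gen_units carmichael_ring_ZFact that)
  have iso: "R \<simeq> ZFact 1 \<longleftrightarrow> card (carrier R) = 1" for R :: "int set ring"
    using iso_ZFact_1[of R] ring_iso_same_card[of R "ZFact 1"] by (auto simp: ZFact_one)
  show ?thesis
    unfolding iso trivial[OF p0] using p0 trivial[of "p ^ \<alpha>" k]
      Carmichael_funpow_prime_power[OF assms(1,2,4,3)] by simp
qed

end
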